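(* Let $G$ be the incidence graph of a $\mathrm{BIBD}(v,b,r,k,\lambda)$ with point set $X$ and block collection $\mathcal{B}$, where $2 \le \lambda \le r-1$. Then $\zeta(G) \le f(G) + r + 1$, where $f(G)$ is defined as follows: for $u \in X$, let $X_1,\dots,X_\alpha$ be the partition of $X\setminus\{u\}$ into maximal nonempty sets such that $\{u\} \cup X_i$ is contained in exactly $\lambda$ blocks (equivalently, $x,y \in X\setminus\{u\}$ lie in the same part iff every block containing $\{u,x\}$ also contains $y$); set $f(u) = \sum_{i=1}^{\alpha} (|X_i| - 1)$ and $f(G) = \min_{u \in X} f(u)$.
   Context: A $\mathrm{BIBD}(v,b,r,k,\lambda)$ (balanced incomplete block design) is a set $X$ of $v$ points together with a collection $\mathcal{B}$ of $b$ blocks (subsets of $X$, possibly repeated) such that every block has size $k$, every point lies in exactly $r$ blocks, and every pair of distinct points lies in exactly $\lambda$ blocks. Its incidence graph is the bipartite graph on $X \cup \mathcal{B}$ (each block a separate vertex) with $x \sim B$ iff $x \in B$. Localization game on a connected graph $G$ with $k$ cops: the robber chooses a starting vertex, invisible to the cops. Each round the cops choose any $k$ vertices (no adjacency restriction) and each learns its distance to the robber; the cops win if after finitely many rounds they determine the robber's vertex uniquely; otherwise the robber moves to a neighbour or stays. The robber knows the cops' strategy. $\zeta(G)$ is the least $k$ for which $k$ cops can guarantee capture. *)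

theory Defs
  imports "HOL-Library.Extended_Nat" "HOL-Library.Disjoint_Sets"
begin

text \<open>
  Blocks are given as a family \<open>blk\<close> over an index set \<open>I\<close>, so that repeated blocks are distinct
  indices. Nonemptiness of \<open>X\<close> is needed for the minimum in \<open>excess_min\<close> to exist.
\<close>

locale bibd =
  fixes X :: "'a set" and I :: "'b set" and blk :: "'b \<Rightarrow> 'a set" and v b r k l :: nat
  assumes finite_points: "finite X" and points_nonempty: "X \<noteq> {}" and card_points: "card X = v"
    and finite_blocks: "finite I" and card_blocks: "card I = b"
    and block_subset: "\<And>i. i \<in> I \<Longrightarrow> blk i \<subseteq> X"
    and block_size: "\<And>i. i \<in> I \<Longrightarrow> card (blk i) = k"
    and replication: "\<And>x. x \<in> X \<Longrightarrow> card {i \<in> I. x \<in> blk i} = r"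
    and balance: "\<And>x y. x \<in> X \<Longrightarrow> y \<in> X \<Longrightarrow> x \<noteq> y \<Longrightarrow> card {i \<in> I. {x, y} \<subseteq> blk i} = l"

definition inc_verts :: "'a set \<Rightarrow> 'b set \<Rightarrow> ('a + 'b) set" where
  "inc_verts X I = X <+> I"

definition inc_edges :: "'a set \<Rightarrow> 'b set \<Rightarrow> ('b \<Rightarrow> 'a set) \<Rightarrow> ('a + 'b) rel" where
  "inc_edges X I blk =
     {(Inl x, Inr i) | x i. x \<in> X \<and> i \<in> I \<and> x \<in> blk i} \<union>
     {(Inr i, Inl x) | x i. x \<in> X \<and> i \<in> I \<and> x \<in> blk i}"

definition gdist :: "'v rel \<Rightarrow> 'v \<Rightarrow> 'v \<Rightarrow> enat" where
  "gdist E p q = (INF n \<in> {n. (p, q) \<in> E ^^ n}. enat n)"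

text \<open>
  A play of the robber is the sequence of its positions, \<open>w n\<close> being its position when the cops
  probe in round \<open>n\<close> (rounds are counted from \<open>0\<close>). A cop strategy maps the list of all previous
  answers to the next list of probed vertices. As such a strategy is deterministic and known to the
  robber, guaranteed capture means capture on every play.
\<close>

definition robber_play :: "'v set \<Rightarrow> 'v rel \<Rightarrow> (nat \<Rightarrow> 'v) \<Rightarrow> bool" where
  "robber_play V E w \<longleftrightarrow> w 0 \<in> V \<and> (\<forall>n. w (Suc n) = w n \<or> (w n, w (Suc n)) \<in> E)"

definition cop_strategy :: "'v set \<Rightarrow> nat \<Rightarrow> (enat list list \<Rightarrow> 'v list) \<Rightarrow> bool" where
  "cop_strategy V m \<sigma> \<longleftrightarrow> (\<forall>h. length (\<sigma> h) = m \<and> set (\<sigma> h) \<subseteq> V)"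

primrec answers ::
  "'v rel \<Rightarrow> (enat list list \<Rightarrow> 'v list) \<Rightarrow> (nat \<Rightarrow> 'v) \<Rightarrow> nat \<Rightarrow> enat list list" where
  "answers E \<sigma> w 0 = []"
| "answers E \<sigma> w (Suc n) =
     answers E \<sigma> w n @ [map (\<lambda>c. gdist E c (w n)) (\<sigma> (answers E \<sigma> w n))]"

text \<open>Every play giving the same answers in rounds \<open>0, \<dots>, n\<close> has the same position in round \<open>n\<close>.\<close>

definition located ::
  "'v set \<Rightarrow> 'v rel \<Rightarrow> (enat list list \<Rightarrow> 'v list) \<Rightarrow> (nat \<Rightarrow> 'v) \<Rightarrow> nat \<Rightarrow> bool" where
  "located V E \<sigma> w n \<longleftrightarrow>
     (\<forall>w'. robber_play V E w' \<and> answers E \<sigma> w' (Suc n) = answers E \<sigma> w (Suc n) \<longrightarrow> w' n = w n)"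

definition cops_win :: "'v set \<Rightarrow> 'v rel \<Rightarrow> nat \<Rightarrow> bool" where
  "cops_win V E m \<longleftrightarrow>
     (\<exists>\<sigma>. cop_strategy V m \<sigma> \<and> (\<forall>w. robber_play V E w \<longrightarrow> (\<exists>n. located V E \<sigma> w n)))"

definition localization_number :: "'v set \<Rightarrow> 'v rel \<Rightarrow> nat" where
  "localization_number V E = (LEAST m. cops_win V E m)"

definition full_set :: "'a set \<Rightarrow> 'b set \<Rightarrow> ('b \<Rightarrow> 'a set) \<Rightarrow> nat \<Rightarrow> 'a \<Rightarrow> 'a set \<Rightarrow> bool" where
  "full_set X I blk l u P \<longleftrightarrow>
     P \<noteq> {} \<and> P \<subseteq> X - {u} \<and> card {i \<in> I. {u} \<union> P \<subseteq> blk i} = l"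

definition parts :: "'a set \<Rightarrow> 'b set \<Rightarrow> ('b \<Rightarrow> 'a set) \<Rightarrow> nat \<Rightarrow> 'a \<Rightarrow> 'a set set" where
  "parts X I blk l u =
     {P. full_set X I blk l u P \<and> (\<forall>Q. full_set X I blk l u Q \<and> P \<subseteq> Q \<longrightarrow> Q = P)}"

definition excess :: "'a set \<Rightarrow> 'b set \<Rightarrow> ('b \<Rightarrow> 'a set) \<Rightarrow> nat \<Rightarrow> 'a \<Rightarrow> nat" where
  "excess X I blk l u = (\<Sum>P \<in> parts X I blk l u. card P - 1)"

definition excess_min :: "'a set \<Rightarrow> 'b set \<Rightarrow> ('b \<Rightarrow> 'a set) \<Rightarrow> nat \<Rightarrow> nat" where
  "excess_min X I blk l = Min (excess X I blk l ` X)"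

context bibd
begin

definition cls :: "'a \<Rightarrow> 'a \<Rightarrow> 'a set" where
  "cls u x = {y \<in> X - {u}. \<forall>i \<in> I. {u, x} \<subseteq> blk i \<longrightarrow> y \<in> blk i}"

lemma full_set_iff:
  assumes "u \<in> X" "x \<in> P"
  shows "full_set X I blk l u P \<longleftrightarrow> P \<subseteq> cls u x \<and> x \<in> X - {u}"
proof -
  let ?A = "{i \<in> I. {u} \<union> P \<subseteq> blk i}" and ?B = "{i \<in> I. {u, x} \<subseteq> blk i}"
  have sub: "?A \<subseteq> ?B" and fin: "finite ?B"
    using assms finite_blocks by auto
  show ?thesis
  proof
    assume f: "full_set X I blk l u P"
    then have x: "x \<in> X - {u}" using assms by (auto simp: full_set_def)
    then have "card ?B = l" using balance[of u x] assms by auto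
    then have "?A = ?B" using f sub fin by (intro card_subset_eq) (auto simp: full_set_def)
    then show "P \<subseteq> cls u x \<and> x \<in> X - {u}"
      using f x by (auto simp: cls_def full_set_def)
  next
    assume p: "P \<subseteq> cls u x \<and> x \<in> X - {u}"
    then have "?A = ?B" using sub by (auto simp: cls_def)
    moreover have "card ?B = l" using balance[of u x] p assms by auto
    ultimately show "full_set X I blk l u P"
      using p assms by (auto simp: full_set_def cls_def)
  qed
qed

lemma parts_eq:
  assumes "u \<in> X"
  shows "parts X I blk l u = cls u ` (X - {u})"
proof -
  have self: "x \<in> cls u x" if "x \<in> X - {u}" for x
    using that by (auto simp: cls_def)
  have full: "full_set X I blk l u (cls u x)" if "x \<in> X - {u}" for x
    using full_set_iff[OF assms self[OF that]] that by simp
  show ?thesis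
  proof (intro equalityI subsetI)
    fix P assume P: "P \<in> parts X I blk l u"
    then obtain x where x: "x \<in> P" by (auto simp: parts_def full_set_def)
    have "P \<subseteq> cls u x \<and> x \<in> X - {u}"
      using P full_set_iff[OF assms x] by (simp add: parts_def)
    then show "P \<in> cls u ` (X - {u})"
      using P full by (auto simp: parts_def)
  next
    fix P assume "P \<in> cls u ` (X - {u})"
    then obtain x where x: "x \<in> X - {u}" "P = cls u x" by auto
    have "Q = P" if "full_set X I blk l u Q" "P \<subseteq> Q" for Q
      using that self x full_set_iff[OF assms, of x Q] by blast
    then show "P \<in> parts X I blk l u"
      using x full by (auto simp: parts_def)
  qed
qed

lemma partition_parts:
  assumes "u \<in> X"
  shows "partition_on (X - {u}) (parts X I blk l u)"
proof -
  have self: "x \<in> cls u x" if "x \<in> X - {u}" for x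
    using that by (auto simp: cls_def)
  have union: "\<Union> (parts X I blk l u) = X - {u}"
    using self unfolding parts_eq[OF assms] by (fastforce simp: cls_def)
  have nonempty: "p \<noteq> {}" if "p \<in> parts X I blk l u" for p
    using that by (simp add: parts_def full_set_def)
  have disj: "disjnt p q" if pq: "p \<in> parts X I blk l u" "q \<in> parts X I blk l u" "p \<noteq> q" for p q
  proof (rule ccontr)
    assume "\<not> disjnt p q"
    then obtain z where z: "z \<in> p" "z \<in> q" by (auto simp: disjnt_def)
    have "p \<subseteq> cls u z" "q \<subseteq> cls u z" "z \<in> X - {u}"
      using pq full_set_iff[OF assms z(1)] full_set_iff[OF assms z(2)] by (auto simp: parts_def)
    moreover have "full_set X I blk l u (cls u z)"
      using full_set_iff[OF assms self] calculation by blast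
    ultimately show False using pq by (auto simp: parts_def)
  qed
  have "disjoint (parts X I blk l u)"
    using disj by (auto simp: disjoint_def disjnt_def)
  then show ?thesis
    using union nonempty unfolding partition_on_def by blast
qed

lemma same_part_iff:
  assumes "u \<in> X" "x \<in> X - {u}" "y \<in> X - {u}"
  shows "(\<exists>P \<in> parts X I blk l u. x \<in> P \<and> y \<in> P) \<longleftrightarrow>
    (\<forall>i \<in> I. {u, x} \<subseteq> blk i \<longrightarrow> y \<in> blk i)"
proof
  assume "\<exists>P \<in> parts X I blk l u. x \<in> P \<and> y \<in> P"
  then obtain P where "P \<in> parts X I blk l u" "x \<in> P" "y \<in> P" by auto
  then have "y \<in> cls u x" using full_set_iff[of u x P] assms by (auto simp: parts_def)
  then show "\<forall>i \<in> I. {u, x} \<subseteq> blk i \<longrightarrow> y \<in> blk i" by (simp add: cls_def)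
next
  assume "\<forall>i \<in> I. {u, x} \<subseteq> blk i \<longrightarrow> y \<in> blk i"
  then have "x \<in> cls u x" "y \<in> cls u x" using assms by (auto simp: cls_def)
  then show "\<exists>P \<in> parts X I blk l u. x \<in> P \<and> y \<in> P"
    using assms by (auto simp: parts_eq)
qed

lemma incidence_graph_connected:
  assumes "2 \<le> l" "l \<le> r - 1" "p \<in> inc_verts X I" "q \<in> inc_verts X I"
  shows "(p, q) \<in> (inc_edges X I blk)\<^sup>*"
proof -
  let ?E = "inc_edges X I blk"
  obtain u where u: "u \<in> X" using points_nonempty by auto
  have "{i \<in> I. u \<in> blk i} \<noteq> {}"
    using replication[OF u] assms(1,2) by (metis card.empty diff_0_eq_0 le_zero_eq not_numeral_le_zero)
  then obtain i0 where i0: "i0 \<in> I" "u \<in> blk i0" by auto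
  have "finite (blk i0)" using finite_points block_subset[OF i0(1)] finite_subset by blast
  then have k: "k > 0" using block_size[OF i0(1)] i0(2) by (auto simp: card_gt_0_iff)
  have sym: "sym ?E" by (auto simp: sym_def inc_edges_def)
  have pt: "(Inl x, Inl u) \<in> ?E\<^sup>*" if x: "x \<in> X" for x
  proof (cases "x = u")
    case False
    have "{i \<in> I. {x, u} \<subseteq> blk i} \<noteq> {}"
      using balance[OF x u False] assms(1) by (metis card.empty not_numeral_le_zero)
    then obtain i where "i \<in> I" "x \<in> blk i" "u \<in> blk i" by auto
    then have "(Inl x, Inr i) \<in> ?E" "(Inr i, Inl u) \<in> ?E"
      using x u by (auto simp: inc_edges_def)
    then show ?thesis by (meson converse_rtrancl_into_rtrancl r_into_rtrancl)
  qed simp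
  have all: "(p, Inl u) \<in> ?E\<^sup>*" if p: "p \<in> inc_verts X I" for p
  proof (cases p)
    case (Inl x)
    then show ?thesis using p pt by (auto simp: inc_verts_def)
  next
    case (Inr i)
    then have i: "i \<in> I" using p by (auto simp: inc_verts_def)
    then obtain x where x: "x \<in> blk i" using block_size[OF i] k by fastforce
    then have "x \<in> X" "(p, Inl x) \<in> ?E"
      using block_subset[OF i] i Inr by (auto simp: inc_edges_def)
    then show ?thesis using pt by (meson converse_rtrancl_into_rtrancl)
  qed
  have "(Inl u, q) \<in> ?E\<^sup>*" using all[OF assms(4)] sym sym_rtrancl symD by metis
  then show ?thesis using all[OF assms(3)] by (rule rtrancl_trans[rotated])
qed

end

end

theory Submission imports Defs "HOL-Library.Countable_Set" begin

text \<open>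
  Choose \<open>u\<close> minimising the excess and, in every round, probe the \<open>r\<close> blocks through \<open>u\<close> and all but
  one point of each part of \<open>X - {u}\<close>. These probes identify the robber whenever it sits on a point:
  the blocks through \<open>u\<close> at distance \<open>1\<close> determine the part, and the probed points single out the
  element of the part. Blocks are pairwise nonadjacent, so a robber that is never on a point never
  moves, and one further cop that runs through all the blocks finds it.
\<close>

lemma gdist_eq_enat_imp_relpow:
  assumes "gdist E p q = enat n"
  shows "(p, q) \<in> E ^^ n"
proof -
  let ?A = "enat ` {n. (p, q) \<in> E ^^ n}"
  have "Inf ?A = enat n" using assms by (simp add: gdist_def)
  \<comment> \<open>The infimum of the empty set is \<open>\<infinity>\<close>, so a finite value
    means that some walk exists and that the least length is attained.\<close>
  then have "?A \<noteq> {}" "(LEAST x. x \<in> ?A) = enat n"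
    by (auto simp: Inf_enat_def split: if_splits)
  then have "enat n \<in> ?A" by (metis LeastI ex_in_conv)
  then show ?thesis by auto
qed

lemma gdist_le:
  assumes "(p, q) \<in> E ^^ n"
  shows "gdist E p q \<le> enat n"
  unfolding gdist_def using assms by (intro INF_lower) simp

lemma gdist_eq_0_iff: "gdist E p q = 0 \<longleftrightarrow> p = q"
  using gdist_eq_enat_imp_relpow[of E p q 0] gdist_le[of p q 0 E]
  by (auto simp: zero_enat_def[symmetric])

lemma gdist_eq_1_iff:
  assumes "p \<noteq> q"
  shows "gdist E p q = 1 \<longleftrightarrow> (p, q) \<in> E"
proof
  assume "gdist E p q = 1"
  then show "(p, q) \<in> E"
    using gdist_eq_enat_imp_relpow[of E p q 1] by (simp add: one_enat_def)
next
  assume "(p, q) \<in> E"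
  then have "gdist E p q \<le> 1"
    using gdist_le[of p q 1 E] by (simp add: one_enat_def)
  moreover have "gdist E p q \<noteq> 0" using assms by (simp add: gdist_eq_0_iff)
  ultimately show "gdist E p q = 1" by (metis antisym ileI1 one_eSuc zero_less_iff_neq_zero)
qed

lemma length_answers: "length (answers E \<sigma> w n) = n"
  by (induction n) auto

text \<open>Equal answer lists have equal prefixes, and the strategy sees nothing else, so both
  plays face the same probes in round \<open>n\<close>.\<close>

lemma answers_Suc_eq_imp_gdist_eq:
  assumes "answers E \<sigma> w' (Suc n) = answers E \<sigma> w (Suc n)" "c \<in> set (\<sigma> (answers E \<sigma> w n))"
  shows "gdist E c (w' n) = gdist E c (w n)"
  using assms by auto

lemma robber_play_in_verts:
  assumes "robber_play V E w" "E \<subseteq> V \<times> V"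
  shows "w n \<in> V"
  using assms by (induction n) (auto simp: robber_play_def, (metis SigmaD2 subsetD)+)

lemma inc_edges_subset: "inc_edges X I blk \<subseteq> inc_verts X I \<times> inc_verts X I"
  by (auto simp: inc_edges_def inc_verts_def)

lemma robber_on_blocks_stays:
  assumes "robber_play V (inc_edges X I blk) w" "\<And>n x. w n \<noteq> Inl x"
  shows "w n = w 0"
proof (induction n)
  case (Suc n)
  have "(w n, w (Suc n)) \<notin> inc_edges X I blk"
    using assms(2) unfolding inc_edges_def by blast
  then have "w (Suc n) = w n" using assms(1) unfolding robber_play_def by blast
  then show ?case using Suc by simp
qed simp

context bibd
begin

abbreviation "verts \<equiv> inc_verts X I"
abbreviation "edges \<equiv> inc_edges X I blk"

text \<open>This turns a probe of a block into a membership test, where \<open>q\<close> may be the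
  still unknown vertex of a competing play.\<close>

lemma gdist_block_eq_1_iff:
  assumes "i \<in> I"
  shows "gdist edges (Inr i) q = 1 \<longleftrightarrow> (\<exists>x \<in> blk i. q = Inl x)"
proof (cases "q = Inr i")
  case True
  then have "gdist edges (Inr i) q = 0" by (simp add: gdist_eq_0_iff)
  then show ?thesis using True by simp
next
  case False
  then show ?thesis
    using assms block_subset[OF assms]
    by (subst gdist_eq_1_iff) (auto simp: inc_edges_def)
qed

text \<open>Dropping one representative from each part leaves disjoint sets, each smaller by one, so
  their sizes add up to the excess. Two points of one part outside \<open>S\<close> are both its
  representative.\<close>

lemma ex_part_separating_points:
  assumes u: "u \<in> X"
  obtains S where "S \<subseteq> X" "card S = excess X I blk l u"
    "\<And>P x y. P \<in> parts X I blk l u \<Longrightarrow> x \<in> P \<Longrightarrow> y \<in> P \<Longrightarrow> x \<notin> S \<Longrightarrow> y \<notin> S \<Longrightarrow> x = y"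
proof -
  let ?Q = "parts X I blk l u"
  note part = partition_parts[OF u]
  define rep where "rep P = (SOME x. x \<in> P)" for P :: "'a set"
  define S where "S = (\<Union>P \<in> ?Q. P - {rep P})"
  have rep: "rep P \<in> P" if "P \<in> ?Q" for P
    using that unfolding rep_def by (auto simp: parts_def full_set_def some_in_eq)
  have sub: "P \<subseteq> X" if "P \<in> ?Q" for P
    using that by (auto simp: parts_def full_set_def)
  then have fin: "finite P" if "P \<in> ?Q" for P
    using that finite_points finite_subset by blast
  have finQ: "finite ?Q" using finite_points parts_eq[OF u] by simp
  have "card S = (\<Sum>P \<in> ?Q. card (P - {rep P}))"
    unfolding S_def
  proof (rule card_UN_disjoint[OF finQ])
    show "\<forall>P \<in> ?Q. \<forall>R \<in> ?Q. P \<noteq> R \<longrightarrow> (P - {rep P}) \<inter> (R - {rep R}) = {}"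
      using part by (auto simp: partition_on_def disjoint_def)
  qed (use fin in auto)
  also have "\<dots> = excess X I blk l u"
    unfolding excess_def using rep fin by (intro sum.cong) auto
  finally have "card S = excess X I blk l u" .
  moreover have "S \<subseteq> X" using sub by (auto simp: S_def)
  moreover have "x = y" if "P \<in> ?Q" "x \<in> P" "y \<in> P" "x \<notin> S" "y \<notin> S" for P x y
    using that unfolding S_def by blast
  ultimately show ?thesis using that by blast
qed

text \<open>The choice of \<open>u\<close> is left open here; minimality enters only in the final
  theorem.\<close>

lemma cops_win_excess:
  assumes u: "u \<in> X" and l: "0 < l" "l < r"
  shows "cops_win verts edges (excess X I blk l u + r + 1)"
proof -
  let ?B = "{i \<in> I. u \<in> blk i}"
  obtain S where S: "S \<subseteq> X" "card S = excess X I blk l u"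
    and sep: "\<And>P x y. P \<in> parts X I blk l u \<Longrightarrow> x \<in> P \<Longrightarrow> y \<in> P \<Longrightarrow> x \<notin> S \<Longrightarrow> y \<notin> S \<Longrightarrow> x = y"
    using ex_part_separating_points[OF u] by blast
  have finB: "finite ?B" using finite_blocks by simp
  obtain bs where bs: "set bs = ?B" "length bs = r"
    using finite_distinct_list[OF finB] replication[OF u] by (metis distinct_card)
  obtain ps where ps: "set ps = S" "length ps = excess X I blk l u"
    using finite_distinct_list[OF finite_subset[OF S(1) finite_points]] S(2)
    by (metis distinct_card)
  have B_nonempty: "?B \<noteq> {}"
    using bs l by (metis length_greater_0_conv less_trans set_empty)
  \<comment> \<open>\<open>I\<close> is finite and, by \<open>B_nonempty\<close>, nonempty, so a
    sequence with repetitions has range exactly \<open>I\<close>, and each of its probes is a legal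
    vertex.\<close>
  obtain e :: "nat \<Rightarrow> 'b" where e: "range e = I"
    using range_from_nat_into[OF _ countable_finite[OF finite_blocks]] B_nonempty by blast
  \<comment> \<open>The length of the history is the round number, so the last cop probes
    \<open>e n\<close> in round \<open>n\<close>; the other probes are the same in every
    round.\<close>
  define \<sigma> :: "enat list list \<Rightarrow> ('a + 'b) list"
    where "\<sigma> h = map Inr bs @ map Inl ps @ [Inr (e (length h))]" for h
  have strategy: "cop_strategy verts (excess X I blk l u + r + 1) \<sigma>"
    using bs ps S(1) e by (auto simp: cop_strategy_def \<sigma>_def inc_verts_def)
  have "\<exists>n. located verts edges \<sigma> w n" if w: "robber_play verts edges w" for w
  proof (cases "\<exists>n x. w n = Inl x")
    case True
    then obtain n x where wn: "w n = Inl x" by blast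
    then have x: "x \<in> X"
      using robber_play_in_verts[OF w inc_edges_subset, of n] by (auto simp: inc_verts_def)
    have "w' n = w n"
      if w': "robber_play verts edges w'"
        and ans: "answers edges \<sigma> w' (Suc n) = answers edges \<sigma> w (Suc n)" for w'
    proof -
      note same = answers_Suc_eq_imp_gdist_eq[OF ans]
      have same_block: "(\<exists>y \<in> blk i. w' n = Inl y) \<longleftrightarrow> x \<in> blk i" if i: "i \<in> ?B" for i
      proof -
        have "Inr i \<in> set (\<sigma> (answers edges \<sigma> w n))" using i bs(1) by (auto simp: \<sigma>_def)
        from same[OF this] show ?thesis
          using gdist_block_eq_1_iff[of i "w' n"] gdist_block_eq_1_iff[of i "w n"] i wn by auto
      qed
      have same_point: "w' n = Inl s \<longleftrightarrow> x = s" if s: "s \<in> S" for s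
      proof -
        have "Inl s \<in> set (\<sigma> (answers edges \<sigma> w n))" using s ps(1) by (auto simp: \<sigma>_def)
        from same[OF this] show ?thesis
          using wn by (metis Inl_inject gdist_eq_0_iff)
      qed
      \<comment> \<open>As \<open>0 < l\<close>, the blocks through \<open>u\<close> cover all
        points. Hence some probed block answers \<open>1\<close> when the robber is on
        \<open>x\<close>, which forces \<open>w' n\<close> to be a point too.\<close>
      have ex_common: "\<exists>i \<in> ?B. z \<in> blk i" if z: "z \<in> X" for z
      proof (cases "z = u")
        case False
        then have "{i \<in> I. {z, u} \<subseteq> blk i} \<noteq> {}"
          using balance[OF z u] l(1) by (metis card.empty less_irrefl)
        then show ?thesis by auto
      qed (use B_nonempty in auto)
      obtain y where y: "w' n = Inl y"
        using ex_common[OF x] same_block by blast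
      then have yX: "y \<in> X"
        using robber_play_in_verts[OF w' inc_edges_subset, of n] by (auto simp: inc_verts_def)
      have iff: "y \<in> blk i \<longleftrightarrow> x \<in> blk i" if "i \<in> ?B" for i
        using same_block[OF that] y by auto
      \<comment> \<open>The point \<open>u\<close> lies in all \<open>r\<close> blocks of
        \<open>?B\<close>, any other point in only \<open>l < r\<close> of them, so the block
        answers tell \<open>u\<close> apart.\<close>
      have not_all: "\<exists>i \<in> ?B. z \<notin> blk i" if z: "z \<in> X" "z \<noteq> u" for z
      proof (rule ccontr)
        assume "\<not> ?thesis"
        then have "{i \<in> I. {z, u} \<subseteq> blk i} = ?B" by auto
        then show False using balance[OF z(1) u z(2)] replication[OF u] l by simp
      qed
      have "x = y"
      proof (cases "x = u \<or> y = u")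
        case True
        then show ?thesis using not_all[OF x] not_all[OF yX] iff by blast
      next
        case False
        then have "\<exists>P \<in> parts X I blk l u. x \<in> P \<and> y \<in> P"
          using same_part_iff[OF u, of x y] x yX iff by auto
        \<comment> \<open>If \<open>x\<close> or \<open>y\<close> is in \<open>S\<close>, the probe
          there answers \<open>0\<close> in both plays; otherwise both are the one unprobed point of
          their part.\<close>
        then show ?thesis using sep same_point[of x] same_point[of y] y by (metis Inl_inject)
      qed
      then show ?thesis using y wn by simp
    qed
    then show ?thesis unfolding located_def by blast
  next
    case False
    then have stay: "w n = w 0" for n using robber_on_blocks_stays[OF w] by blast
    obtain i where i: "w 0 = Inr i" using False by (metis sum.exhaust)
    then have "i \<in> I" using w by (auto simp: robber_play_def inc_verts_def)
    then obtain n where n: "e n = i" using e by blast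
    \<comment> \<open>The play \<open>w'\<close> may well visit points; the distance
      \<open>0\<close> from the probed vertex \<open>w n\<close> alone fixes
      \<open>w' n\<close>.\<close>
    have "w' n = w n" if "answers edges \<sigma> w' (Suc n) = answers edges \<sigma> w (Suc n)" for w'
    proof -
      have "w n \<in> set (\<sigma> (answers edges \<sigma> w n))"
        using i n stay by (simp add: \<sigma>_def length_answers)
      from answers_Suc_eq_imp_gdist_eq[OF that this] show ?thesis
        by (metis gdist_eq_0_iff)
    qed
    then show ?thesis unfolding located_def by blast
  qed
  then show ?thesis unfolding cops_win_def using strategy by blast
qed

end

theorem theorem2p3:
  fixes X :: "'a set" and I :: "'b set" and blk :: "'b \<Rightarrow> 'a set"
    and v b r k l :: nat
  assumes "bibd X I blk v b r k l"
    and "2 \<le> l" and "l \<le> r - 1"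
  shows "localization_number (inc_verts X I) (inc_edges X I blk) \<le> excess_min X I blk l + r + 1"
proof -
  interpret bibd X I blk v b r k l by fact
  have "excess_min X I blk l \<in> excess X I blk l ` X"
    unfolding excess_min_def using finite_points points_nonempty by (intro Min_in) auto
  then obtain u where "u \<in> X" "excess_min X I blk l = excess X I blk l u" by blast
  \<comment> \<open>The subtraction in \<open>r - 1\<close> is truncated, but
    \<open>2 \<le> l\<close> excludes \<open>r = 0\<close>, so the inequality is strict.\<close>
  moreover have "0 < l" "l < r" using assms(2,3) by auto
  ultimately have "cops_win (inc_verts X I) (inc_edges X I blk) (excess_min X I blk l + r + 1)"
    using cops_win_excess by simp
  then show ?thesis unfolding localization_number_def by (rule Least_le)
qed

end
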